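(* Let $K$ be a perfect field, let $P=K[x_1,\dots,x_n]$, and let $I$ be a zero-dimensional ideal in $P$. The following procedure terminates and returns true if $I$ is a radical ideal, and false otherwise. 1. Compute $d=\dim_K(P/I)$. 2. For $i=1,\dots,n$ do: 2.1. compute $\mu=\mu_{x_i,I}$; 2.2. if $\mu$ is not square-free then return false; 2.3. if $\deg(\mu)=d$ then return true. 3. Return true.
   Context: An ideal $I$ of $P$ is zero-dimensional if $P/I$ is non-zero and finite-dimensional over $K$. For $f\in P$, the minimal polynomial $\mu_{f,I}(z)\in K[z]$ is the monic generator of the kernel of the $K$-algebra homomorphism $K[z]\to P/I$, $z\mapsto f\bmod I$. In characteristic $p>0$, the field $K$ is assumed to have effective $p$-th roots (so that square-freeness can be tested); the basic operations in the procedure are assumed to be computable. *)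

theory Defs
  imports
    "HOL-Library.Poly_Mapping"
    "HOL-Algebra.Embedded_Algebras"
    "HOL-Algebra.QuotRing"
    "HOL-Computational_Algebra.Polynomial"
    "HOL-Computational_Algebra.Squarefree"
begin

definition perfect_field :: "'k::field itself \<Rightarrow> bool" where
  "perfect_field _ \<longleftrightarrow> CHAR('k) = 0 \<or> (\<forall>a::'k. \<exists>b. b ^ CHAR('k) = a)"

text \<open>
  Polynomials with coefficients in the field \<open>'k\<close> are finitely supported maps from exponent
  vectors to \<open>'k\<close>, and exponent vectors are finitely supported maps from variable indices to
  exponents. This type has countably many variables; \<open>mpoly_ring n\<close> is the subring of the
  polynomials in \<open>x\<^sub>1, \<dots>, x\<^sub>n\<close>.
\<close>

type_synonym 'k mpoly = "(nat \<Rightarrow>\<^sub>0 nat) \<Rightarrow>\<^sub>0 'k"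

definition mpoly_ring :: "nat \<Rightarrow> 'k::field mpoly ring" where
  "mpoly_ring n =
     \<lparr>carrier = {p. \<forall>m \<in> Poly_Mapping.keys p. Poly_Mapping.keys m \<subseteq> {1..n}},
      monoid.mult = (*), one = 1, ring.zero = 0, add = (+)\<rparr>"

definition mconst :: "'k::field \<Rightarrow> 'k mpoly" where
  "mconst c = Poly_Mapping.single 0 c"

definition mvar :: "nat \<Rightarrow> 'k::field mpoly" where
  "mvar i = Poly_Mapping.single (Poly_Mapping.single i 1) 1"

text \<open>
  The quotient \<open>P/I\<close> is a vector space over \<open>K\<close> via the copy of \<open>K\<close> formed by the residue
  classes of the constant polynomials (a subfield of \<open>P/I\<close> as soon as \<open>I \<noteq> P\<close>).
\<close>

definition quot_consts :: "nat \<Rightarrow> 'k::field mpoly set \<Rightarrow> 'k mpoly set set" where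
  "quot_consts n I = range (\<lambda>c. I +>\<^bsub>mpoly_ring n\<^esub> mconst c)"

definition zero_dimensional :: "nat \<Rightarrow> 'k::field mpoly set \<Rightarrow> bool" where
  "zero_dimensional n I \<longleftrightarrow>
     ideal I (mpoly_ring n) \<and>
     carrier (mpoly_ring n Quot I) \<noteq> {\<zero>\<^bsub>mpoly_ring n Quot I\<^esub>} \<and>
     ring.finite_dimension (mpoly_ring n Quot I) (quot_consts n I)
       (carrier (mpoly_ring n Quot I))"

definition quot_dim :: "nat \<Rightarrow> 'k::field mpoly set \<Rightarrow> nat" where
  "quot_dim n I =
     ring.dim (mpoly_ring n Quot I) (quot_consts n I) (carrier (mpoly_ring n Quot I))"

text \<open>The homomorphism \<open>K[z] \<rightarrow> P/I\<close> that sends \<open>z\<close> to the residue class of \<open>f\<close>.\<close>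

definition eval_mod :: "nat \<Rightarrow> 'k::field mpoly set \<Rightarrow> 'k mpoly \<Rightarrow> 'k poly \<Rightarrow> 'k mpoly set" where
  "eval_mod n I f g = I +>\<^bsub>mpoly_ring n\<^esub> poly (map_poly mconst g) f"

definition min_poly :: "nat \<Rightarrow> 'k::field mpoly set \<Rightarrow> 'k mpoly \<Rightarrow> 'k poly" where
  "min_poly n I f =
     (THE \<mu>. lead_coeff \<mu> = 1 \<and>
       {g. eval_mod n I f g = \<zero>\<^bsub>mpoly_ring n Quot I\<^esub>} = {g. \<mu> dvd g})"

definition ideal_radical :: "('a, 'b) ring_scheme \<Rightarrow> 'a set \<Rightarrow> 'a set" where
  "ideal_radical R I = {f \<in> carrier R. \<exists>k::nat. f [^]\<^bsub>R\<^esub> k \<in> I}"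

definition radical_ideal :: "'a set \<Rightarrow> ('a, 'b) ring_scheme \<Rightarrow> bool" where
  "radical_ideal I R \<longleftrightarrow> ideal I R \<and> ideal_radical R I = I"

text \<open>
  The procedure as a partial function: \<open>None\<close> means that it does not terminate, \<open>Some b\<close>
  that it terminates and returns \<open>b\<close>. The loop is run from step \<open>i\<close> onwards.
\<close>

partial_function (option) radical_test_loop ::
  "nat \<Rightarrow> 'k::field mpoly set \<Rightarrow> nat \<Rightarrow> nat \<Rightarrow> bool option" where
  "radical_test_loop n I d i =
     (if i \<le> n then
        (let \<mu> = min_poly n I (mvar i) in
         if \<not> squarefree \<mu> then Some False
         else if Polynomial.degree \<mu> = d then Some True
         else radical_test_loop n I d (i + 1))
      else Some True)"

definition radical_test :: "nat \<Rightarrow> 'k::field mpoly set \<Rightarrow> bool option" where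
  "radical_test n I = (let d = quot_dim n I in radical_test_loop n I d 1)"

end

theory Submission
  imports Defs "HOL-Algebra.Algebraic_Closure_Type"
begin

text \<open>
  Write \<open>\<mu>\<^sub>i\<close> for the minimal polynomial of \<open>x\<^sub>i\<close> modulo \<open>I\<close> and \<open>d\<close> for the dimension of \<open>P/I\<close>.
  The procedure has three ways to stop, and each answer has its own reason.

  It answers false because some \<open>\<mu>\<^sub>i\<close> is not square-free. If \<open>\<mu>\<^sub>i = g\<^sup>2 h\<close> with \<open>g\<close> not a
  unit, then the class of \<open>(g h)(x\<^sub>i)\<close> is nilpotent, but it is not zero because \<open>\<mu>\<^sub>i\<close> does not divide
  \<open>g h\<close>; so \<open>I\<close> is not radical (\<open>squarefree_min_poly_if_radical\<close>).

  It answers true because some square-free \<open>\<mu>\<^sub>i\<close> has degree \<open>d\<close>. Then the powers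
  \<open>1, x\<^sub>i, \<dots>, x\<^sub>i\<^sup>d\<^sup>-\<^sup>1\<close> are independent modulo \<open>I\<close>, hence a basis, and \<open>P/I\<close> is isomorphic to
  \<open>K[z]/\<mu>\<^sub>i\<close>, which is reduced (\<open>radical_if_squarefree_of_max_degree\<close>).

  It answers true after the loop, when all \<open>\<mu>\<^sub>i\<close> are square-free. This is Seidenberg's lemma
  (\<open>radical_if_squarefree_in_each_variable\<close>). As \<open>K\<close> is perfect, every \<open>\<mu>\<^sub>i\<close> has distinct roots
  in the algebraic closure \<open>L\<close> (\<open>squarefree_splits_distinct\<close>). One passes to an ideal \<open>M\<close> of \<open>L[x\<^sub>1, \<dots>, x\<^sub>n]\<close> that contracts to
  \<open>I\<close> (\<open>ex_scalar_extension\<close>) and argues there as for commuting diagonalizable operators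
  (\<open>split_ideal_radical\<close>). If \<open>f\<close> is not in \<open>M\<close>, then multiplying by suitable Lagrange
  interpolation polynomials in \<open>x\<^sub>1\<close>, then \<open>x\<^sub>2\<close>, and so on, yields \<open>g\<close> with \<open>g f\<close> not in \<open>M\<close> whose
  class is a common eigenvector of the multiplications by all variables. It is then an eigenvector of the
  multiplication by \<open>f\<close> as well; the eigenvalue is not zero because \<open>g f\<close> is not in \<open>M\<close>, so no
  power of \<open>f\<close> lies in \<open>M\<close>.
\<close>

text \<open>From here on, degrees, leading coefficients and primes are those of the types of polynomials and numbers.\<close>

hide_const (open) Polynomials.degree Polynomials.lead_coeff Poly_Mapping.degree Divisibility.prime

section \<open>Evaluating polynomials along a coefficient homomorphism\<close>

text \<open>
  Used for the inclusion of \<open>K\<close> into its algebraic closure, for the constants of a polynomial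
  ring, and for the extension of scalars between polynomial rings.
\<close>

locale coeff_hom =
  fixes h :: "'a::comm_ring_1 \<Rightarrow> 'b::comm_ring_1"
  assumes hom_1 [simp]: "h 1 = 1"
    and hom_add [simp]: "h (a + b) = h a + h b"
    and hom_mult [simp]: "h (a * b) = h a * h b"
begin

lemma hom_0 [simp]: "h 0 = 0"
  using hom_add[of 0 0] by simp

lemma hom_uminus [simp]: "h (- a) = - h a"
  using hom_add[of "- a" a] by (simp add: eq_neg_iff_add_eq_0 del: hom_add)

lemma eval_pCons [simp]: "poly (map_poly h (pCons a p)) x = h a + x * poly (map_poly h p) x"
  by (simp add: map_poly_pCons)

lemma eval_add [simp]:
  "poly (map_poly h (p + q)) x = poly (map_poly h p) x + poly (map_poly h q) x"
proof (induction p arbitrary: q)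
  case (pCons a p)
  obtain b r where "q = pCons b r"
    by (rule pCons_cases)
  then show ?case
    by (simp add: pCons.IH algebra_simps)
qed simp

lemma eval_smult [simp]: "poly (map_poly h (smult c p)) x = h c * poly (map_poly h p) x"
  by (induction p) (simp_all add: algebra_simps)

lemma eval_mult [simp]:
  "poly (map_poly h (p * q)) x = poly (map_poly h p) x * poly (map_poly h q) x"
  by (induction p) (simp_all add: algebra_simps)

lemma eval_power [simp]: "poly (map_poly h (p ^ k)) x = poly (map_poly h p) x ^ k"
  by (induction k) simp_all

lemma eval_sum: "poly (map_poly h (\<Sum>a\<in>A. p a)) x = (\<Sum>a\<in>A. poly (map_poly h (p a)) x)"
  by (induction A rule: infinite_finite_induct) simp_all

end

section \<open>Ideals and divisibility in \<open>K[z]\<close>\<close>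

text \<open>
  This provides the generators of the kernel of \<open>K[z] \<rightarrow> P/I\<close> and of the kernel of the evaluation at
  an algebraic element, and also greatest common divisors.
\<close>

lemma poly_ideal_principal:
  fixes N :: "'k::field poly set"
  assumes add: "\<And>p q. p \<in> N \<Longrightarrow> q \<in> N \<Longrightarrow> p + q \<in> N"
    and mult: "\<And>p q. q \<in> N \<Longrightarrow> p * q \<in> N"
    and nz: "g \<in> N" "g \<noteq> 0"
  shows "\<exists>\<mu>. lead_coeff \<mu> = 1 \<and> N = {p. \<mu> dvd p}"
proof -
  have "\<exists>q. (q \<in> N \<and> q \<noteq> 0) \<and> (\<forall>p. p \<in> N \<and> p \<noteq> 0 \<longrightarrow> degree q \<le> degree p)"
    using ex_has_least_nat[of "\<lambda>q. q \<in> N \<and> q \<noteq> 0" g degree] nz by blast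
  then obtain q where q: "q \<in> N" "q \<noteq> 0"
    and min: "\<And>p. p \<in> N \<Longrightarrow> p \<noteq> 0 \<Longrightarrow> degree q \<le> degree p"
    by blast
  define \<mu> where "\<mu> = smult (inverse (lead_coeff q)) q"
  have lc: "lead_coeff \<mu> = 1" and \<mu>N: "\<mu> \<in> N" and deg: "degree \<mu> = degree q"
    using q mult[of q "[:inverse (lead_coeff q):]"] by (simp_all add: \<mu>_def)
  have "\<mu> dvd p" if p: "p \<in> N" for p
  proof -
    have "p mod \<mu> = p + (- (p div \<mu>)) * \<mu>"
      using div_mult_mod_eq[of p \<mu>] by (simp add: algebra_simps)
    then have "p mod \<mu> \<in> N"
      by (simp only: add[OF p mult[OF \<mu>N]])
    moreover have "p mod \<mu> = 0 \<or> degree (p mod \<mu>) < degree \<mu>"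
      using lc by (intro degree_mod_less) auto
    ultimately show "\<mu> dvd p"
      using min[of "p mod \<mu>"] deg dvd_eq_mod_eq_0 by fastforce
  qed
  moreover have "p \<in> N" if "\<mu> dvd p" for p
    using that mult[OF \<mu>N] by (auto elim!: dvdE simp: mult.commute)
  ultimately show ?thesis
    using lc by blast
qed

lemma monic_dvd_antisym:
  fixes p q :: "'k::field poly"
  assumes "lead_coeff p = 1" "lead_coeff q = 1" "p dvd q" "q dvd p"
  shows "p = q"
proof -
  obtain r where r: "q = p * r"
    using assms(3) by blast
  have nz: "p \<noteq> 0" "q \<noteq> 0" "r \<noteq> 0"
    using assms(1,2) r by auto
  have "degree p + degree r \<le> degree p"
    using dvd_imp_degree_le[OF assms(4) nz(1)] nz by (simp add: r degree_mult_eq)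
  then obtain c where c: "r = [:c:]"
    by (metis add_le_same_cancel1 degree_eq_zeroE le_zero_eq)
  have "lead_coeff q = lead_coeff p * lead_coeff r"
    unfolding r by (rule lead_coeff_mult)
  then have "c = 1"
    using assms(1,2) c by simp
  then show ?thesis
    by (simp add: r c)
qed

lemma degree_Poly_less: "Poly cs \<noteq> 0 \<Longrightarrow> degree (Poly cs) < length cs"
  using leading_coeff_0_iff[of "Poly cs"]
  by (auto simp: nth_default_def simp del: leading_coeff_0_iff split: if_splits)

lemma poly_bezout:
  fixes p q :: "'k::field poly"
  assumes "p \<noteq> 0"
  shows "\<exists>d. d dvd p \<and> d dvd q \<and> (\<exists>a b. d = a * p + b * q)"
proof -
  define N where "N = {a * p + b * q | a b. True}"
  have "\<exists>d. lead_coeff d = 1 \<and> N = {x. d dvd x}"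
  proof (rule poly_ideal_principal)
    fix x y assume "x \<in> N" "y \<in> N"
    then obtain a b a' b' where "x = a * p + b * q" "y = a' * p + b' * q"
      by (auto simp: N_def)
    then have "x + y = (a + a') * p + (b + b') * q"
      by (simp add: algebra_simps)
    then show "x + y \<in> N"
      by (auto simp: N_def)
  next
    fix x y assume "y \<in> N"
    then obtain a b where "y = a * p + b * q"
      by (auto simp: N_def)
    then have "x * y = (x * a) * p + (x * b) * q"
      by (simp add: algebra_simps)
    then show "x * y \<in> N"
      by (auto simp: N_def)
  next
    have "p = 1 * p + 0 * q"
      by simp
    then show "p \<in> N"
      unfolding N_def by blast
  qed (rule assms)
  then obtain d where "N = {x. d dvd x}"
    by blast
  then have d: "x \<in> N \<longleftrightarrow> d dvd x" for x
    by simp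
  have "p = 1 * p + 0 * q" "q = 0 * p + 1 * q"
    by simp_all
  then have "p \<in> N" "q \<in> N"
    unfolding N_def by blast+
  moreover have "d \<in> N"
    using d by simp
  then obtain a b where "d = a * p + b * q"
    unfolding N_def by blast
  ultimately show ?thesis
    using d by blast
qed

text \<open>
  This is the reducedness of \<open>K[z]/\<mu>\<close>. With \<open>q = gcd \<mu> g\<close> and \<open>\<mu> = q r\<close>, a common divisor of
  \<open>r\<close> and \<open>g\<close> divides both \<open>q\<close> and \<open>r\<close>, so its square divides \<open>\<mu>\<close> and it is a unit. Hence \<open>r\<close> is
  coprime to \<open>g\<close>, and dividing \<open>g ^ k\<close> it must be a unit too.
\<close>

lemma squarefree_dvd_power:
  fixes \<mu> g :: "'k::field poly"
  assumes sf: "squarefree \<mu>" and dvd: "\<mu> dvd g ^ k"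
  shows "\<mu> dvd g"
proof -
  have "\<mu> \<noteq> 0"
    using sf by auto
  then obtain q a b where q: "q dvd \<mu>" "q dvd g" "q = a * \<mu> + b * g"
    using poly_bezout[of \<mu> g] by blast
  then obtain r where r: "\<mu> = q * r"
    by blast
  then have "r \<noteq> 0"
    using \<open>\<mu> \<noteq> 0\<close> by auto
  then obtain t c e where t: "t dvd r" "t dvd g" "t = c * r + e * g"
    using poly_bezout[of r g] by blast
  have "t dvd q"
    unfolding q(3) using t(1,2) by (simp add: r)
  then have "t * t dvd \<mu>"
    unfolding r using t(1) by (rule mult_dvd_mono)
  then have "t dvd 1"
    using squarefreeD[OF sf, of t] by (simp add: power2_eq_square)
  have "r dvd t ^ j - (e * g) ^ j" for j
  proof (induction j)
    case (Suc j)
    have "t ^ Suc j - (e * g) ^ Suc j = t * (t ^ j - (e * g) ^ j) + (e * g) ^ j * (t - e * g)"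
      by (simp add: algebra_simps)
    moreover have "r dvd t - e * g"
      by (simp add: t(3))
    ultimately show ?case
      using Suc by simp
  qed simp
  moreover have "r dvd (e * g) ^ k"
    unfolding power_mult_distrib using dvd_mult_right[of q r "g ^ k"] dvd r by (intro dvd_mult) simp
  ultimately have "r dvd (t ^ k - (e * g) ^ k) + (e * g) ^ k"
    by (rule dvd_add)
  then have "r dvd t ^ k"
    by simp
  moreover have "t ^ k dvd 1"
    using dvd_power_same[OF \<open>t dvd 1\<close>, of k] by simp
  ultimately have "r dvd 1"
    by (rule dvd_trans)
  then have "\<mu> dvd q"
    using mult_dvd_mono[OF dvd_refl, of r 1 q] by (simp add: r)
  then show ?thesis
    using q(2) by (rule dvd_trans)
qed

section \<open>Square-free polynomials over a perfect field\<close>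

interpretation to_ac: coeff_hom to_ac
  by unfold_locales simp_all

text \<open>
  If the derivative vanishes, only exponents divisible by the characteristic \<open>p\<close> occur, and replacing
  the coefficients by their \<open>p\<close>-th roots exhibits \<open>q\<close> as a \<open>p\<close>-th power by the freshman's dream.
\<close>

lemma perfect_pderiv_0_imp_power:
  fixes q :: "'k::field poly"
  assumes "perfect_field TYPE('k)" "pderiv q = 0" "degree q > 0"
  shows "prime CHAR('k) \<and> (\<exists>r. q = r ^ CHAR('k))"
proof -
  define p where "p = CHAR('k)"
  have dvd: "p dvd m" if "coeff q m \<noteq> 0" for m
  proof (cases m)
    case (Suc k)
    have "of_nat (Suc k) * coeff q (Suc k) = coeff (pderiv q) k"
      by (simp only: coeff_pderiv)
    then have "of_nat m = (0 :: 'k)"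
      using that assms(2) by (simp add: Suc)
    then show ?thesis
      by (simp add: p_def of_nat_eq_0_iff_char_dvd)
  qed simp
  have "p dvd degree q"
    using dvd[of "degree q"] assms(3) by (metis degree_0 leading_coeff_0_iff less_irrefl)
  then have "p > 0"
    using assms(3) by (auto intro!: Nat.gr0I)
  then have pr: "prime p"
    unfolding p_def by (rule prime_CHAR_semidom)
  have "\<forall>a::'k. \<exists>b. b ^ p = a"
    using assms(1) \<open>p > 0\<close> by (simp add: perfect_field_def p_def)
  then obtain root where root: "\<And>a::'k. root a ^ p = a"
    by metis
  define r where "r = (\<Sum>i\<le>degree q. monom (root (coeff q (p * i))) i)"
  have "r ^ p = (\<Sum>i\<le>degree q. monom (coeff q (p * i)) (p * i))"
    using pr by (simp add: r_def freshmans_dream_sum p_def monom_power root[unfolded p_def] mult.commute)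
  also have "\<dots> = (\<Sum>m \<in> (*) p ` {..degree q}. monom (coeff q m) m)"
    using \<open>p > 0\<close> by (subst sum.reindex) (auto simp: inj_on_def)
  also have "\<dots> = (\<Sum>m\<le>degree q. monom (coeff q m) m)"
  proof (intro sum.mono_neutral_cong)
    fix m assume m: "m \<in> {..degree q} - (*) p ` {..degree q}"
    show "monom (coeff q m) m = 0"
    proof (rule ccontr)
      assume "monom (coeff q m) m \<noteq> 0"
      then obtain i where "m = p * i"
        using dvd[of m] by (auto elim!: dvdE)
      moreover have "i \<le> p * i"
        using \<open>p > 0\<close> by simp
      moreover have "m \<le> degree q"
        using m by simp
      ultimately have "i \<le> degree q"
        by linarith
      then have "m \<in> (*) p ` {..degree q}"
        using \<open>m = p * i\<close> by blast
      then show False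
        using m by simp
    qed
  next
    fix m assume "m \<in> (*) p ` {..degree q} - {..degree q}"
    then show "monom (coeff q m) m = 0"
      by (auto simp: coeff_eq_0)
  qed auto
  also have "\<dots> = q"
    by (rule poly_as_sum_of_monoms)
  finally show ?thesis
    using pr by (auto simp: p_def)
qed

text \<open>
  Let \<open>q\<close> be the minimal polynomial over \<open>K\<close> of a double root and \<open>\<mu> = q r\<close>. Then \<open>q\<close> divides
  \<open>r\<close>, against square-freeness, or divides its own derivative, which is therefore zero. In the
  latter case \<open>q\<close> is a \<open>p\<close>-th power of a polynomial of smaller degree with the same root, against
  its minimality.
\<close>

lemma squarefree_no_double_root:
  fixes \<mu> :: "'k::field poly" and a :: "'k alg_closure"
  assumes perf: "perfect_field TYPE('k)" and sf: "squarefree \<mu>"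
    and root: "poly (map_poly to_ac \<mu>) a = 0"
  shows "poly (map_poly to_ac (pderiv \<mu>)) a \<noteq> 0"
proof
  assume droot: "poly (map_poly to_ac (pderiv \<mu>)) a = 0"
  define N where "N = {p. poly (map_poly to_ac p) a = 0}"
  have "\<mu> \<noteq> 0"
    using sf by auto
  then obtain q where lc: "lead_coeff q = 1" and N: "N = {p. q dvd p}"
    using poly_ideal_principal[of N \<mu>] root by (auto simp: N_def)
  have q_dvd: "poly (map_poly to_ac p) a = 0 \<longleftrightarrow> q dvd p" for p
    using N by (auto simp: N_def set_eq_iff)
  have nunit: "\<not> q dvd 1"
    using q_dvd[of 1] by simp
  have "degree q > 0"
    using nunit lc by (intro Nat.gr0I) (auto elim!: degree_eq_zeroE simp: one_pCons)
  obtain r where r: "\<mu> = q * r"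
    using q_dvd root by blast
  have q0: "poly (map_poly to_ac q) a = 0"
    using q_dvd[of q] by simp
  have "poly (map_poly to_ac (pderiv q)) a * poly (map_poly to_ac r) a = 0"
    using droot q0 by (auto simp: r pderiv_mult)
  then consider "q dvd r" | "q dvd pderiv q"
    using q_dvd[of r] q_dvd[of "pderiv q"] by (auto simp del: map_poly_eq_0_iff)
  then show False
  proof cases
    case 1
    then have "q ^ 2 dvd \<mu>"
      by (simp add: r power2_eq_square)
    then show False
      using sf nunit squarefreeD by blast
  next
    case 2
    have "pderiv q = 0"
    proof (rule ccontr)
      assume "pderiv q \<noteq> 0"
      then have "degree q \<le> degree (pderiv q)"
        using 2 by (rule dvd_imp_degree_le[rotated])
      also have "\<dots> \<le> degree q - 1"
        by (intro degree_le) (auto simp: coeff_pderiv coeff_eq_0)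
      finally show False
        using \<open>degree q > 0\<close> by simp
    qed
    then obtain s where pr: "prime CHAR('k)" and s: "q = s ^ CHAR('k)"
      using perfect_pderiv_0_imp_power[OF perf] \<open>degree q > 0\<close> by blast
    have "poly (map_poly to_ac s) a = 0"
      using q0 by (simp add: s)
    then have "q dvd s"
      using q_dvd by simp
    moreover have "s \<noteq> 0"
      using \<open>degree q > 0\<close> prime_gt_0_nat[OF pr] by (auto simp: s power_0_left)
    ultimately have "degree q \<le> degree s"
      by (intro dvd_imp_degree_le)
    moreover have "degree q = CHAR('k) * degree s"
      by (subst s) (simp add: degree_power_eq \<open>s \<noteq> 0\<close>)
    ultimately have "CHAR('k) * degree s \<le> 1 * degree s" "degree s > 0"
      using \<open>degree q > 0\<close> by auto
    then show False
      using prime_gt_1_nat[OF pr] by simp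
  qed
qed

lemma squarefree_splits_distinct:
  fixes \<mu> :: "'k::field poly"
  assumes perf: "perfect_field TYPE('k)" and sf: "squarefree \<mu>"
  shows "\<exists>S. finite S \<and> map_poly to_ac \<mu> = smult (to_ac (lead_coeff \<mu>)) (\<Prod>a\<in>S. [:-a, 1:])"
proof -
  define q where "q = map_poly to_ac \<mu>"
  have deg: "degree q = degree \<mu>"
    by (simp add: q_def degree_map_poly)
  have "\<mu> \<noteq> 0"
    using sf by auto
  then have "q \<noteq> 0"
    by (simp add: q_def map_poly_eq_0_iff)
  then obtain A where A: "q = smult (lead_coeff q) (\<Prod>x\<in>#A. [:-x, 1:])"
    using alg_closed_imp_factorization by blast
  have pd: "pderiv q = map_poly to_ac (pderiv \<mu>)"
    by (intro poly_eqI) (simp add: q_def coeff_pderiv coeff_map_poly flip: to_ac_of_nat)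
  have "count A a = 1" if a: "a \<in># A" for a
  proof (rule ccontr)
    assume "count A a \<noteq> 1"
    then have "count A a > 1"
      using a by (metis One_nat_def count_greater_zero_iff nat_neq_iff less_one not_less_zero)
    then have "count (A - {#a#}) a > 0"
      by simp
    then obtain B where "A - {#a#} = add_mset a B"
      by (metis count_greater_zero_iff multi_member_split)
    then have "A = add_mset a (add_mset a B)"
      using a by (metis insert_DiffM)
    then have "q = smult (lead_coeff q) ([:-a, 1:] * ([:-a, 1:] * (\<Prod>x\<in>#B. [:-x, 1:])))"
      using A by simp
    then have "q = [:-a, 1:] * ([:-a, 1:] * smult (lead_coeff q) (\<Prod>x\<in>#B. [:-x, 1:]))"
      by (simp only: mult_smult_right)
    then obtain r where r: "q = [:-a, 1:] * ([:-a, 1:] * r)"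
      by blast
    have "poly q a = 0" "poly (pderiv q) a = 0"
      by (simp_all add: r pderiv_mult del: mult_pCons_left)
    then show False
      using squarefree_no_double_root[OF perf sf, of a] by (simp add: q_def[symmetric] pd)
  qed
  then have "A = mset_set (set_mset A)"
    by (intro multiset_eqI) (metis count_mset_set(1,3) finite_set_mset not_in_iff)
  then have "(\<Prod>x\<in>#A. [:-x, 1:]) = (\<Prod>a\<in>set_mset A. [:-a, 1:])"
    by (simp add: prod_unfold_prod_mset)
  moreover have "lead_coeff q = to_ac (lead_coeff \<mu>)"
    by (simp only: deg) (simp add: q_def coeff_map_poly)
  ultimately show ?thesis
    using A by (intro exI[of _ "set_mset A"]) (simp add: q_def)
qed

section \<open>Polynomial rings in finitely many variables\<close>

lemma mem_mpoly_ring: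
  "p \<in> carrier (mpoly_ring n) \<longleftrightarrow> (\<forall>m \<in> Poly_Mapping.keys p. Poly_Mapping.keys m \<subseteq> {1..n})"
  by (simp add: mpoly_ring_def)

lemma mpoly_ring_ops [simp]:
  "monoid.mult (mpoly_ring n) = (*)" "one (mpoly_ring n) = 1"
  "zero (mpoly_ring n) = 0" "add (mpoly_ring n) = (+)"
  by (simp_all add: mpoly_ring_def)

lemma mpoly_ring_0 [simp]: "0 \<in> carrier (mpoly_ring n)"
  by (simp add: mem_mpoly_ring)

lemma mpoly_ring_1 [simp]: "1 \<in> carrier (mpoly_ring n)"
  by (simp add: mem_mpoly_ring)

lemma mpoly_ring_mconst [simp]: "mconst c \<in> carrier (mpoly_ring n)"
  by (simp add: mem_mpoly_ring mconst_def)

lemma mpoly_ring_mvar [simp]: "i \<in> {1..n} \<Longrightarrow> mvar i \<in> carrier (mpoly_ring n)"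
  by (simp add: mem_mpoly_ring mvar_def)

lemma mpoly_ring_add [simp]:
  "p \<in> carrier (mpoly_ring n) \<Longrightarrow> q \<in> carrier (mpoly_ring n) \<Longrightarrow> p + q \<in> carrier (mpoly_ring n)"
  using Poly_Mapping.keys_add[of p q] by (auto simp: mem_mpoly_ring)

lemma mpoly_ring_mult [simp]:
  assumes "p \<in> carrier (mpoly_ring n)" "q \<in> carrier (mpoly_ring n)"
  shows "p * q \<in> carrier (mpoly_ring n)"
  unfolding mem_mpoly_ring
proof
  fix m assume "m \<in> Poly_Mapping.keys (p * q)"
  then obtain a b where "m = a + b" "a \<in> Poly_Mapping.keys p" "b \<in> Poly_Mapping.keys q"
    using keys_mult[of p q] by blast
  then show "Poly_Mapping.keys m \<subseteq> {1..n}"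
    using assms Poly_Mapping.keys_add[of a b] by (fastforce simp: mem_mpoly_ring)
qed

lemma mpoly_ring_uminus [simp]:
  "p \<in> carrier (mpoly_ring n) \<Longrightarrow> - p \<in> carrier (mpoly_ring n)"
  by (simp add: mem_mpoly_ring in_keys_iff)

lemma mpoly_ring_diff [simp]:
  "p \<in> carrier (mpoly_ring n) \<Longrightarrow> q \<in> carrier (mpoly_ring n) \<Longrightarrow> p - q \<in> carrier (mpoly_ring n)"
  using mpoly_ring_add[of p n "- q"] by simp

lemma mpoly_ring_power [simp]:
  "p \<in> carrier (mpoly_ring n) \<Longrightarrow> p ^ k \<in> carrier (mpoly_ring n)"
  by (induction k) simp_all

lemma cring_mpoly_ring: "cring (mpoly_ring n :: 'k::field mpoly ring)"
proof (intro cringI abelian_groupI comm_monoidI)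
  fix x :: "'k mpoly"
  assume "x \<in> carrier (mpoly_ring n)"
  then have "- x \<in> carrier (mpoly_ring n)" "- x + x = 0"
    by simp_all
  then show "\<exists>y\<in>carrier (mpoly_ring n). y \<oplus>\<^bsub>mpoly_ring n\<^esub> x = \<zero>\<^bsub>mpoly_ring n\<^esub>"
    by (metis mpoly_ring_ops(3,4))
qed (simp_all add: algebra_simps)

lemma mpoly_ring_nat_pow [simp]: "p [^]\<^bsub>mpoly_ring n\<^esub> (k::nat) = p ^ k"
proof -
  interpret cring "mpoly_ring n" by (rule cring_mpoly_ring)
  show ?thesis by (induction k) (simp_all add: mult.commute)
qed

lemma mpoly_ring_a_inv:
  assumes "p \<in> carrier (mpoly_ring n)"
  shows "\<ominus>\<^bsub>mpoly_ring n\<^esub> p = - p"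
proof -
  interpret cring "mpoly_ring n" by (rule cring_mpoly_ring)
  show ?thesis
    using minus_equality[of "- p" p] assms by simp
qed

lemma mpoly_ring_a_minus:
  assumes "p \<in> carrier (mpoly_ring n)" "q \<in> carrier (mpoly_ring n)"
  shows "p \<ominus>\<^bsub>mpoly_ring n\<^esub> q = p - q"
  using assms by (simp add: a_minus_def mpoly_ring_a_inv)

lemma poly_mapping_as_sum:
  fixes p :: "'a \<Rightarrow>\<^sub>0 'b::comm_monoid_add"
  shows "p = (\<Sum>m\<in>Poly_Mapping.keys p. Poly_Mapping.single m (Poly_Mapping.lookup p m))"
  by (rule poly_mapping_eqI) (simp add: lookup_sum lookup_single when_def in_keys_iff)

lemma poly_mapping_additive_induct [case_names zero single add]:
  fixes p :: "'a \<Rightarrow>\<^sub>0 'b::comm_monoid_add"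
  assumes "Q 0" "\<And>m c. m \<in> Poly_Mapping.keys p \<Longrightarrow> Q (Poly_Mapping.single m c)"
    and "\<And>p q. Q p \<Longrightarrow> Q q \<Longrightarrow> Q (p + q)"
  shows "Q p"
proof -
  have "Q (\<Sum>m\<in>A. Poly_Mapping.single m (Poly_Mapping.lookup p m))"
    if "finite A" "A \<subseteq> Poly_Mapping.keys p" for A
    using that by (induction A) (auto intro: assms)
  then show ?thesis
    using poly_mapping_as_sum[of p] by (metis finite_keys order_refl)
qed

text \<open>
  \<open>P\<close> is generated as a ring by the constants and the variables; multiplying by one variable at
  a time keeps the induction step simple.
\<close>

lemma mpoly_ring_induct [consumes 1, case_names const var add]:
  assumes p: "p \<in> carrier (mpoly_ring n)"
    and const: "\<And>c. Q (mconst c)"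
    and var: "\<And>i p. i \<in> {1..n} \<Longrightarrow> p \<in> carrier (mpoly_ring n) \<Longrightarrow> Q p \<Longrightarrow> Q (mvar i * p)"
    and add: "\<And>p q. p \<in> carrier (mpoly_ring n) \<Longrightarrow> q \<in> carrier (mpoly_ring n) \<Longrightarrow>
                Q p \<Longrightarrow> Q q \<Longrightarrow> Q (p + q)"
  shows "Q p"
proof -
  have mon: "Poly_Mapping.single m c \<in> carrier (mpoly_ring n) \<and> Q (Poly_Mapping.single m c)"
    if "Poly_Mapping.keys m \<subseteq> {1..n}" for m c
    using that
    \<comment> \<open>Induction on the total degree of the monomial.\<close>
  proof (induction "\<Sum>i\<in>{1..n}. Poly_Mapping.lookup m i" arbitrary: m)
    case 0
    then have "Poly_Mapping.lookup m i = 0" for i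
      by (cases "i \<in> {1..n}") (auto simp: in_keys_iff)
    then have "m = 0"
      by (intro poly_mapping_eqI) simp
    then show ?case
      using const[of c] by (simp add: mconst_def mem_mpoly_ring)
  next
    case (Suc s)
    then obtain i where i: "i \<in> {1..n}" "Poly_Mapping.lookup m i > 0"
      by (metis (no_types, lifting) Zero_neq_Suc gr0I sum.neutral)
    define m' where "m' = m - Poly_Mapping.single i 1"
    have look: "Poly_Mapping.lookup m' j = (if j = i then Poly_Mapping.lookup m i - 1 else Poly_Mapping.lookup m j)" for j
      by (auto simp: m'_def lookup_minus lookup_single)
    have m: "m = Poly_Mapping.single i 1 + m'"
      using i by (intro poly_mapping_eqI) (auto simp: lookup_add look lookup_single when_def)
    have "(\<Sum>j\<in>{1..n}. Poly_Mapping.lookup m j) = Suc (\<Sum>j\<in>{1..n}. Poly_Mapping.lookup m' j)"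
      using i(1) by (subst m) (simp add: lookup_add sum.distrib lookup_single when_def sum.delta')
    then have "s = (\<Sum>j\<in>{1..n}. Poly_Mapping.lookup m' j)"
      using Suc.hyps(2) by simp
    moreover have "Poly_Mapping.keys m' \<subseteq> {1..n}"
      using Suc.prems by (auto simp: subset_iff in_keys_iff look split: if_splits)
    ultimately have "Poly_Mapping.single m' c \<in> carrier (mpoly_ring n)"
      "Q (Poly_Mapping.single m' c)"
      using Suc.hyps(1) by blast+
    moreover have "Poly_Mapping.single m c = mvar i * Poly_Mapping.single m' c"
      by (simp add: mvar_def mult_single m[symmetric, simplified])
    ultimately show ?case
      using var[OF i(1)] i(1) by simp
  qed
  have "p \<in> carrier (mpoly_ring n) \<and> Q p"
  proof (induction p rule: poly_mapping_additive_induct)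
    case zero
    then show ?case using const[of 0] by (simp add: mconst_def)
  next
    case (single m c)
    then show ?case using mon p by (auto simp: mem_mpoly_ring)
  next
    case (add p q)
    then show ?case using assms(4) by simp
  qed
  then show ?thesis ..
qed

interpretation mconst: coeff_hom "mconst :: 'k::field \<Rightarrow> 'k mpoly"
  by unfold_locales (simp_all add: mconst_def single_add mult_single)

lemma mpoly_ring_eval [simp]:
  "f \<in> carrier (mpoly_ring n) \<Longrightarrow> poly (map_poly mconst g) f \<in> carrier (mpoly_ring n)"
  by (induction g) simp_all

section \<open>Ideals of polynomial rings\<close>

lemma mpoly_ideal_simps:
  assumes "ideal I (mpoly_ring n)"
  shows mpoly_ideal_carrier: "p \<in> I \<Longrightarrow> p \<in> carrier (mpoly_ring n)"
    and mpoly_ideal_0: "0 \<in> I"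
    and mpoly_ideal_add: "p \<in> I \<Longrightarrow> q \<in> I \<Longrightarrow> p + q \<in> I"
    and mpoly_ideal_diff: "p \<in> I \<Longrightarrow> q \<in> I \<Longrightarrow> p - q \<in> I"
    and mpoly_ideal_mult: "p \<in> I \<Longrightarrow> q \<in> carrier (mpoly_ring n) \<Longrightarrow> q * p \<in> I"
proof -
  interpret ideal I "mpoly_ring n" by fact
  show c: "p \<in> I \<Longrightarrow> p \<in> carrier (mpoly_ring n)"
    by (rule a_Hcarr)
  show "0 \<in> I"
    using additive_subgroup.zero_closed[OF ideal.axioms(1)[OF assms]] by simp
  show add: "p \<in> I \<Longrightarrow> q \<in> I \<Longrightarrow> p + q \<in> I" for q
    using additive_subgroup.a_closed[OF ideal.axioms(1)[OF assms], of p q] by simp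
  show mult: "p \<in> I \<Longrightarrow> q \<in> carrier (mpoly_ring n) \<Longrightarrow> q * p \<in> I" for p q
    using I_l_closed[of p q] by simp
  show "p \<in> I \<Longrightarrow> q \<in> I \<Longrightarrow> p - q \<in> I"
    using add[of "- q"] mult[of q "- 1"] by simp
qed

lemma mpoly_idealI:
  fixes I :: "'k::field mpoly set"
  assumes "I \<subseteq> carrier (mpoly_ring n)" "0 \<in> I" "\<And>p q. p \<in> I \<Longrightarrow> q \<in> I \<Longrightarrow> p + q \<in> I"
    and mult: "\<And>p q. p \<in> I \<Longrightarrow> q \<in> carrier (mpoly_ring n) \<Longrightarrow> q * p \<in> I"
  shows "ideal I (mpoly_ring n)"
proof -
  interpret cring "mpoly_ring n :: 'k mpoly ring" by (rule cring_mpoly_ring)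
  have "- p \<in> I" if "p \<in> I" for p
    using mult[of p "- 1"] that by simp
  moreover have "inv\<^bsub>add_monoid (mpoly_ring n)\<^esub> p = - p" if "p \<in> I" for p
    using mpoly_ring_a_inv[of p n] that assms(1) by (auto simp: a_inv_def)
  ultimately have "subgroup I (add_monoid (mpoly_ring n :: 'k mpoly ring))"
    by (intro subgroup.intro) (use assms in simp_all)
  then show ?thesis
    using ring_axioms by (intro idealI) (use mult in \<open>auto simp: mult.commute\<close>)
qed

lemma radical_ideal_iff:
  assumes "ideal I (mpoly_ring n)"
  shows "radical_ideal I (mpoly_ring n) \<longleftrightarrow>
           (\<forall>f \<in> carrier (mpoly_ring n). \<forall>k. f ^ k \<in> I \<longrightarrow> f \<in> I)"
proof -
  have "\<exists>k. f ^ k \<in> I" if "f \<in> I" for f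
    using that by (intro exI[of _ 1]) simp
  then show ?thesis
    using assms mpoly_ideal_carrier[OF assms]
    by (auto simp: radical_ideal_def ideal_radical_def)
qed

section \<open>Ideals with split zeros\<close>

text \<open>The interpolation formula for the constant \<open>1\<close> with nodes \<open>S\<close>.\<close>

lemma lagrange_partition:
  fixes S :: "'l::field set"
  assumes "finite S" "S \<noteq> {}"
  shows "\<exists>c. (\<Sum>a\<in>S. smult (c a) (\<Prod>b\<in>S - {a}. [:-b, 1:])) = 1"
proof -
  define c where "c a = inverse (\<Prod>b\<in>S - {a}. a - b)" for a
  define L where "L = (\<Sum>a\<in>S. smult (c a) (\<Prod>b\<in>S - {a}. [:-b, 1:]))"
  have "degree (smult (c a) (\<Prod>b\<in>S - {a}. [:-b, 1:])) \<le> card S - 1" if "a \<in> S" for a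
  proof -
    have "degree (\<Prod>b\<in>S - {a}. [:-b, 1:]) = card (S - {a})"
      by (subst degree_prod_eq_sum_degree) auto
    then show ?thesis
      using that assms by (simp add: degree_smult_le order_trans[OF degree_smult_le])
  qed
  then have "degree L \<le> card S - 1"
    unfolding L_def by (intro degree_sum_le) (use assms in auto)
  moreover have "card S > 0"
    using assms by (simp add: card_gt_0_iff)
  ultimately have deg: "degree L < card S"
    by simp
  have "L = 1"
  proof (rule poly_eqI_degree[of S])
    fix a assume a: "a \<in> S"
    have "poly (smult (c a') (\<Prod>b\<in>S - {a'}. [:-b, 1:])) a = 0" if "a' \<in> S - {a}" for a'
      using a that assms(1) by (auto simp: poly_prod)
    then have "(\<Sum>a'\<in>S - {a}. poly (smult (c a') (\<Prod>b\<in>S - {a'}. [:-b, 1:])) a) = 0"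
      by (intro sum.neutral) blast
    moreover have "(\<Prod>b\<in>S - {a}. a - b) \<noteq> 0"
      using assms(1) by simp
    then have "poly (smult (c a) (\<Prod>b\<in>S - {a}. [:-b, 1:])) a = 1"
      by (simp add: poly_prod c_def)
    ultimately show "poly L a = poly 1 a"
      unfolding L_def poly_sum by (subst sum.remove[OF assms(1) a]) simp
  qed (use deg \<open>card S > 0\<close> in auto)
  then show ?thesis
    unfolding L_def by blast
qed

text \<open>
  Lagrange's formula writes \<open>u\<close> as a combination of the products of \<open>u\<close> with the interpolation factors
  \<open>\<Prod>b\<in>S - {a}. x - b\<close>, so one of these products is not in \<open>M\<close>; and \<open>x - a\<close> times that factor
  is the full product, which lies in \<open>M\<close>.
\<close>

lemma ex_eigenfactor:
  fixes M :: "'l::field mpoly set"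
  assumes M: "ideal M (mpoly_ring n)" and x: "x \<in> carrier (mpoly_ring n)"
    and S: "finite S" "poly (map_poly mconst (\<Prod>a\<in>S. [:-a, 1:])) x \<in> M"
    and u: "u \<in> carrier (mpoly_ring n)" "u \<notin> M"
  shows "\<exists>a. \<exists>g \<in> carrier (mpoly_ring n). g * u \<notin> M \<and> (x - mconst a) * g \<in> M"
proof -
  define ev where "ev p = poly (map_poly mconst p) x" for p
  have ev_P [simp]: "ev p \<in> carrier (mpoly_ring n)" for p
    using x by (simp add: ev_def)
  have "S \<noteq> {}"
    using S(2) mpoly_ideal_mult[OF M S(2) u(1)] u(2) by auto
  then obtain c where "(\<Sum>a\<in>S. smult (c a) (\<Prod>b\<in>S - {a}. [:-b, 1:])) = 1"
    using lagrange_partition[OF S(1)] by blast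
  then have "ev (\<Sum>a\<in>S. smult (c a) (\<Prod>b\<in>S - {a}. [:-b, 1:])) = 1"
    by (simp add: ev_def)
  then have one: "(\<Sum>a\<in>S. mconst (c a) * ev (\<Prod>b\<in>S - {a}. [:-b, 1:])) = 1"
    by (simp add: ev_def mconst.eval_sum)
  have "\<exists>a\<in>S. ev (\<Prod>b\<in>S - {a}. [:-b, 1:]) * u \<notin> M"
  proof (rule ccontr)
    assume "\<not> ?thesis"
    then have summand: "mconst (c a) * (ev (\<Prod>b\<in>S - {a}. [:-b, 1:]) * u) \<in> M" if "a \<in> S" for a
      using that mpoly_ideal_mult[OF M _ mpoly_ring_mconst] by blast
    have "(\<Sum>a\<in>A. mconst (c a) * (ev (\<Prod>b\<in>S - {a}. [:-b, 1:]) * u)) \<in> M" if "A \<subseteq> S" for A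
      using finite_subset[OF that S(1)] that
      by (induction A rule: finite_induct) (auto intro: mpoly_ideal_0[OF M] mpoly_ideal_add[OF M] summand)
    from this[OF order_refl] have "(\<Sum>a\<in>S. mconst (c a) * ev (\<Prod>b\<in>S - {a}. [:-b, 1:])) * u \<in> M"
      by (simp add: sum_distrib_right mult.assoc)
    then show False
      using one u(2) by simp
  qed
  then obtain a where a: "a \<in> S" "ev (\<Prod>b\<in>S - {a}. [:-b, 1:]) * u \<notin> M"
    by blast
  have "(x - mconst a) * ev (\<Prod>b\<in>S - {a}. [:-b, 1:]) = ev ([:-a, 1:] * (\<Prod>b\<in>S - {a}. [:-b, 1:]))"
    by (simp add: ev_def algebra_simps del: mult_pCons_left)
  also have "\<dots> = ev (\<Prod>b\<in>S. [:-b, 1:])"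
    by (simp add: prod.remove[OF S(1) a(1)] del: mult_pCons_left)
  finally show ?thesis
    using a(2) S(2) x by (intro exI[of _ a] bexI[of _ "ev (\<Prod>b\<in>S - {a}. [:-b, 1:])"]) (simp_all add: ev_def)
qed

text \<open>
  The distinctness of the zeros enters because \<open>S\<close> is a set: it makes the multiplication by each
  variable diagonalizable modulo \<open>M\<close>, and so a class that is not zero can be multiplied to a
  common eigenvector without killing it.
\<close>

lemma split_ideal_radical:
  fixes M :: "'l::field mpoly set"
  assumes M: "ideal M (mpoly_ring n)"
    and S: "\<And>i. i \<in> {1..n} \<Longrightarrow>
              \<exists>S. finite S \<and> poly (map_poly mconst (\<Prod>a\<in>S. [:-a, 1:])) (mvar i) \<in> M"
    and f: "f \<in> carrier (mpoly_ring n)" "f ^ k \<in> M"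
  shows "f \<in> M"
proof (rule ccontr)
  assume "f \<notin> M"
  \<comment> \<open>The factors for different variables are collected one after the other.\<close>
  have "\<exists>g \<in> carrier (mpoly_ring n). g * f \<notin> M \<and>
          (\<forall>i\<in>{1..j}. \<exists>a. (mvar i - mconst a) * g \<in> M)" if "j \<le> n" for j
    using that
  proof (induction j)
    case 0
    then show ?case using \<open>f \<notin> M\<close> by (intro bexI[of _ 1]) auto
  next
    case (Suc j)
    then obtain g where g: "g \<in> carrier (mpoly_ring n)" "g * f \<notin> M"
      "\<forall>i\<in>{1..j}. \<exists>a. (mvar i - mconst a) * g \<in> M"
      by auto
    have "Suc j \<in> {1..n}"
      using Suc.prems by simp
    then obtain a g' where g': "g' \<in> carrier (mpoly_ring n)" "g' * (g * f) \<notin> M"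
      "(mvar (Suc j) - mconst a) * g' \<in> M"
      using ex_eigenfactor[OF M _ _ _ _ g(2), of "mvar (Suc j)"] S[of "Suc j"] g(1) f(1)
      by (metis mpoly_ring_mult mpoly_ring_mvar)
    have "\<exists>a. (mvar i - mconst a) * (g' * g) \<in> M" if i: "i \<in> {1..Suc j}" for i
    proof (cases "i = Suc j")
      case True
      then show ?thesis
        using mpoly_ideal_mult[OF M g'(3) g(1)] by (auto simp: mult_ac)
    next
      case False
      then obtain b where "(mvar i - mconst b) * g \<in> M"
        using i g(3) by (metis atLeastAtMost_iff le_SucE)
      from mpoly_ideal_mult[OF M this g'(1)] show ?thesis
        by (auto simp: mult_ac)
    qed
    then show ?case
      using g(1) g'(1,2) by (intro bexI[of _ "g' * g"]) (auto simp: mult_ac)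
  qed
  from this[OF order_refl] obtain g where g: "g \<in> carrier (mpoly_ring n)" "g * f \<notin> M"
    and eig: "\<And>i. i \<in> {1..n} \<Longrightarrow> \<exists>a. (mvar i - mconst a) * g \<in> M"
    by blast
  \<comment> \<open>An eigenvector of all the variables is one of every polynomial.\<close>
  have "\<exists>c. (h - mconst c) * g \<in> M" if "h \<in> carrier (mpoly_ring n)" for h
    using that
  proof (induction h rule: mpoly_ring_induct)
    case (const c)
    show ?case
      using mpoly_ideal_0[OF M] by (intro exI[of _ c]) simp
  next
    case (var i p)
    then obtain a c where a: "(mvar i - mconst a) * g \<in> M" and c: "(p - mconst c) * g \<in> M"
      using eig by blast
    have "mvar i * ((p - mconst c) * g) + mconst c * ((mvar i - mconst a) * g) \<in> M"
      using var.hyps by (intro mpoly_ideal_add[OF M] mpoly_ideal_mult[OF M] a c) auto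
    then show ?case
      by (intro exI[of _ "c * a"]) (simp add: algebra_simps)
  next
    case (add p q)
    then obtain b c where b: "(p - mconst b) * g \<in> M" and c: "(q - mconst c) * g \<in> M"
      by blast
    from mpoly_ideal_add[OF M b c] show ?case
      by (intro exI[of _ "b + c"]) (simp add: algebra_simps)
  qed
  then obtain c where c: "(f - mconst c) * g \<in> M"
    using f(1) by blast
  have pow: "(f ^ m - mconst (c ^ m)) * g \<in> M" for m
  proof (induction m)
    case 0
    then show ?case using mpoly_ideal_0[OF M] by simp
  next
    case (Suc m)
    have "f * ((f ^ m - mconst (c ^ m)) * g) + mconst (c ^ m) * ((f - mconst c) * g) \<in> M"
      using f(1) by (intro mpoly_ideal_add[OF M] mpoly_ideal_mult[OF M] Suc c) auto
    then show ?case
      by (simp add: algebra_simps)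
  qed
  have "c \<noteq> 0"
    using c g(2) by (auto simp: mult.commute)
  have "g * f ^ k - (f ^ k - mconst (c ^ k)) * g \<in> M"
    using f(2) g(1) by (intro mpoly_ideal_diff[OF M] mpoly_ideal_mult[OF M] pow)
  then have "f * mconst (inverse (c ^ k)) * (mconst (c ^ k) * g) \<in> M"
    using f(1) by (intro mpoly_ideal_mult[OF M, where p = "mconst (c ^ k) * g"]) (simp_all add: algebra_simps)
  also have "f * mconst (inverse (c ^ k)) * (mconst (c ^ k) * g) = f * mconst (inverse (c ^ k) * c ^ k) * g"
    by (simp only: mconst.hom_mult mult.assoc)
  also have "\<dots> = g * f"
    using \<open>c \<noteq> 0\<close> by (simp add: mult.commute)
  finally show False
    using g(2) by simp
qed

section \<open>Extension of scalars to the algebraic closure\<close>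

lemma lookup_map:
  "h 0 = 0 \<Longrightarrow> Poly_Mapping.lookup (Poly_Mapping.map h p) m = h (Poly_Mapping.lookup p m)"
  by (simp add: Poly_Mapping.map.rep_eq when_def)

lemma map_poly_mapping_add:
  fixes h :: "'a::comm_monoid_add \<Rightarrow> 'b::comm_monoid_add"
  assumes "h 0 = 0" "\<And>a b. h (a + b) = h a + h b"
  shows "Poly_Mapping.map h (p + q) = Poly_Mapping.map h p + Poly_Mapping.map h q"
  by (rule poly_mapping_eqI) (simp add: assms lookup_map lookup_add)

lemma map_poly_mapping_0 [simp]: "Poly_Mapping.map h 0 = 0"
  by (rule poly_mapping_eqI) (simp add: Poly_Mapping.map.rep_eq)

lemma map_poly_mapping_single:
  "h 0 = 0 \<Longrightarrow> Poly_Mapping.map h (Poly_Mapping.single m c) = Poly_Mapping.single m (h c)"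
  by (rule poly_mapping_eqI) (simp add: lookup_map lookup_single when_def)

lemma map_mvar_mult:
  fixes h :: "'a::field \<Rightarrow> 'b::field"
  assumes h: "h 0 = 0" "\<And>a b. h (a + b) = h a + h b"
  shows "Poly_Mapping.map h (mvar i * p) = mvar i * Poly_Mapping.map h p"
proof (induction p rule: poly_mapping_additive_induct)
  case (single m c)
  then show ?case
    by (simp add: mvar_def mult_single map_poly_mapping_single h)
next
  case (add p q)
  then show ?case
    by (simp add: distrib_left map_poly_mapping_add h)
qed (simp add: poly_mapping_eqI lookup_map h)

lemma (in coeff_hom) coeff_hom_map:
  "coeff_hom (Poly_Mapping.map h :: ('c::comm_monoid_add \<Rightarrow>\<^sub>0 'a) \<Rightarrow> 'c \<Rightarrow>\<^sub>0 'b)"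
proof
  show "Poly_Mapping.map h 1 = (1 :: 'c \<Rightarrow>\<^sub>0 'b)"
    by (rule poly_mapping_eqI) (simp add: lookup_map lookup_one when_def)
  fix p q :: "'c \<Rightarrow>\<^sub>0 'a"
  show add: "Poly_Mapping.map h (p + q) = Poly_Mapping.map h p + Poly_Mapping.map h q" for p q
    by (simp add: map_poly_mapping_add)
  have single: "Poly_Mapping.map h (Poly_Mapping.single m c * q) =
      Poly_Mapping.map h (Poly_Mapping.single m c) * Poly_Mapping.map h q" for m c
    by (induction q rule: poly_mapping_additive_induct)
      (simp_all add: map_poly_mapping_single mult_single distrib_left add)
  show "Poly_Mapping.map h (p * q) = Poly_Mapping.map h p * Poly_Mapping.map h q"
    by (induction p rule: poly_mapping_additive_induct)
      (simp_all add: single distrib_right add)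
qed

interpretation map_to_ac: coeff_hom
  "Poly_Mapping.map to_ac :: 'k::field mpoly \<Rightarrow> 'k alg_closure mpoly"
  by (rule to_ac.coeff_hom_map)

lemma map_to_ac_eval:
  "Poly_Mapping.map to_ac (poly (map_poly mconst g) (mvar i)) =
     poly (map_poly mconst (map_poly to_ac g)) (mvar i)"
  by (induction g)
    (simp_all add: map_poly_pCons map_mvar_mult mconst_def[abs_def] mvar_def map_poly_mapping_single)

lemma ex_alg_closure_retraction:
  "\<exists>\<phi> :: 'k::field alg_closure \<Rightarrow> 'k.
     (\<forall>x y. \<phi> (x + y) = \<phi> x + \<phi> y) \<and> (\<forall>c x. \<phi> (to_ac c * x) = c * \<phi> x) \<and> \<phi> 1 = 1"
proof -
  interpret vector_space_pair "(*) :: 'k \<Rightarrow> 'k \<Rightarrow> 'k" "\<lambda>c (x :: 'k alg_closure). to_ac c * x"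
    by unfold_locales (simp_all add: algebra_simps)
  have "Vector_Spaces.linear (*) (\<lambda>c x. to_ac c * x) (to_ac :: 'k \<Rightarrow> _)"
    by unfold_locales (simp_all add: algebra_simps)
  from linear_injective_left_inverse[OF this inj_to_ac] obtain \<phi>
    where \<phi>: "Vector_Spaces.linear (\<lambda>c x. to_ac c * x) (*) \<phi>" "\<phi> \<circ> (to_ac :: 'k \<Rightarrow> _) = id"
    by blast
  interpret \<phi>: Vector_Spaces.linear "\<lambda>c (x :: 'k alg_closure). to_ac c * x" "(*)" \<phi>
    by (rule \<phi>(1))
  have "\<phi> (to_ac 1) = 1"
    using \<phi>(2) by (metis comp_apply id_apply)
  then show ?thesis
    using \<phi>.add \<phi>.scale by (intro exI[of _ \<phi>]) simp
qed

text \<open>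
  The extension \<open>I L[x\<^sub>1, \<dots>, x\<^sub>n]\<close> is described dually, through a \<open>K\<close>-linear retraction
  \<open>\<phi>\<close> of \<open>L\<close> onto \<open>K\<close>: \<open>M\<close> consists of the polynomials all of whose \<open>L\<close>-multiples are sent into
  \<open>I\<close> when \<open>\<phi>\<close> is applied to the coefficients. This avoids choosing generators, and \<open>M\<close>
  contracts to \<open>I\<close> simply because \<open>\<phi>\<close> is \<open>K\<close>-linear and fixes \<open>K\<close>.
\<close>

lemma ex_scalar_extension:
  fixes I :: "'k::field mpoly set"
  assumes I: "ideal I (mpoly_ring n)"
  shows "\<exists>M. ideal M (mpoly_ring n) \<and>
           (\<forall>p \<in> carrier (mpoly_ring n). Poly_Mapping.map to_ac p \<in> M \<longleftrightarrow> p \<in> I)"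
proof -
  obtain \<phi> :: "'k alg_closure \<Rightarrow> 'k" where
    add: "\<And>x y. \<phi> (x + y) = \<phi> x + \<phi> y" and scale: "\<And>c x. \<phi> (to_ac c * x) = c * \<phi> x" and "\<phi> 1 = 1"
    using ex_alg_closure_retraction by blast
  have zero: "\<phi> 0 = 0"
    using scale[of 0 0] by simp
  have retr: "\<phi> (to_ac c) = c" for c
    using scale[of c 1] \<open>\<phi> 1 = 1\<close> by simp
  define pr where "pr l F = Poly_Mapping.map (\<lambda>x. \<phi> (l * x)) F"
    for l and F :: "'k alg_closure mpoly"
  define M where "M = {F \<in> carrier (mpoly_ring n :: 'k alg_closure mpoly ring). \<forall>l. pr l F \<in> I}"
  have pr_add: "pr l (F + G) = pr l F + pr l G" for l and F G :: "'k alg_closure mpoly"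
    unfolding pr_def by (rule map_poly_mapping_add) (simp_all add: zero add distrib_left)
  have pr_const: "pr l (mconst c * F) = pr (l * c) F" for l c and F :: "'k alg_closure mpoly"
    unfolding mconst_def mult_map_scale_conv_mult[symmetric] pr_def
    by (rule poly_mapping_eqI) (simp add: lookup_map zero mult.assoc)
  have pr_var: "pr l (mvar i * F) = mvar i * pr l F" for l i and F :: "'k alg_closure mpoly"
    unfolding pr_def by (rule map_mvar_mult) (simp_all add: zero add distrib_left)
  have "ideal M (mpoly_ring n)"
  proof (rule mpoly_idealI)
    have "pr l 0 = 0" for l
      by (simp add: pr_def)
    then show "0 \<in> M"
      using mpoly_ideal_0[OF I] by (simp add: M_def)
    show addM: "p + q \<in> M" if "p \<in> M" "q \<in> M" for p q
      using that mpoly_ideal_add[OF I] by (simp add: M_def pr_add)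
    show "q * p \<in> M" if p: "p \<in> M" and "q \<in> carrier (mpoly_ring n)" for p q
      using that(2)
    proof (induction q rule: mpoly_ring_induct)
      case (const c)
      then show ?case
        using p by (simp add: M_def pr_const)
    next
      case (var i q)
      then show ?case
        using mpoly_ideal_mult[OF I] by (simp add: M_def pr_var mult.assoc)
    next
      case (add q r)
      then show ?case
        using addM by (simp add: distrib_right)
    qed
  qed (simp add: M_def)
  moreover have "Poly_Mapping.map to_ac p \<in> M \<longleftrightarrow> p \<in> I" if p: "p \<in> carrier (mpoly_ring n)" for p
  proof -
    have "Poly_Mapping.keys (Poly_Mapping.map to_ac p) = Poly_Mapping.keys p"
      by (simp add: set_eq_iff in_keys_iff lookup_map)
    then have "Poly_Mapping.map to_ac p \<in> carrier (mpoly_ring n)"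
      using p by (simp add: mem_mpoly_ring)
    moreover have pr_to_ac: "pr l (Poly_Mapping.map to_ac p) = mconst (\<phi> l) * p" for l
      unfolding mconst_def mult_map_scale_conv_mult[symmetric] pr_def
      by (rule poly_mapping_eqI) (simp add: lookup_map zero scale mult.commute[of l] mult.commute[of "\<phi> l"])
    moreover have "mconst (\<phi> l) * p \<in> I" if "p \<in> I" for l
      using that by (intro mpoly_ideal_mult[OF I]) simp_all
    moreover have "p \<in> I" if "\<forall>l. mconst (\<phi> l) * p \<in> I"
      using spec[OF that, of 1] by (simp add: \<open>\<phi> 1 = 1\<close>)
    ultimately show ?thesis
      unfolding M_def by auto
  qed
  ultimately show ?thesis
    by blast
qed

text \<open>
  Seidenberg's lemma: over \<open>L\<close> the given polynomials become products of distinct linear factors, so the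
  extended ideal is radical, and radicality descends to its contraction \<open>I\<close>.
\<close>

lemma radical_if_squarefree_in_each_variable:
  fixes I :: "'k::field mpoly set"
  assumes perf: "perfect_field TYPE('k)" and I: "ideal I (mpoly_ring n)"
    and sf: "\<And>i. i \<in> {1..n} \<Longrightarrow> \<exists>\<mu>. squarefree \<mu> \<and> poly (map_poly mconst \<mu>) (mvar i) \<in> I"
  shows "radical_ideal I (mpoly_ring n)"
proof -
  obtain M where M: "ideal M (mpoly_ring n :: 'k alg_closure mpoly ring)"
    and M_I: "\<And>p. p \<in> carrier (mpoly_ring n) \<Longrightarrow> Poly_Mapping.map to_ac p \<in> M \<longleftrightarrow> p \<in> I"
    using ex_scalar_extension[OF I] by blast
  have "\<exists>S. finite S \<and> poly (map_poly mconst (\<Prod>a\<in>S. [:-a, 1:])) (mvar i) \<in> M"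
    if i: "i \<in> {1..n}" for i
  proof -
    obtain \<mu> where \<mu>: "squarefree \<mu>" "poly (map_poly mconst \<mu>) (mvar i) \<in> I"
      using sf[OF i] by blast
    define c where "c = to_ac (lead_coeff \<mu>)"
    obtain S where S: "finite S" "map_poly to_ac \<mu> = smult c (\<Prod>a\<in>S. [:-a, 1:])"
      using squarefree_splits_distinct[OF perf \<mu>(1)] unfolding c_def by blast
    have "c \<noteq> 0"
      using \<mu>(1) by (auto simp: c_def)
    have "mconst c * poly (map_poly mconst (\<Prod>a\<in>S. [:-a, 1:])) (mvar i) \<in> M"
      using \<mu>(2) M_I[of "poly (map_poly mconst \<mu>) (mvar i)"] mpoly_ideal_carrier[OF I \<mu>(2)]
      by (simp add: map_to_ac_eval S(2))
    from mpoly_ideal_mult[OF M this, of "mconst (inverse c)"]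
    have "mconst (inverse c * c) * poly (map_poly mconst (\<Prod>a\<in>S. [:-a, 1:])) (mvar i) \<in> M"
      by (simp only: mconst.hom_mult mult.assoc mpoly_ring_mconst simp_thms)
    then show ?thesis
      using S(1) \<open>c \<noteq> 0\<close> by auto
  qed
  note split = split_ideal_radical[OF M this]
  have "f \<in> I" if f: "f \<in> carrier (mpoly_ring n)" "f ^ k \<in> I" for f k
  proof -
    have "Poly_Mapping.map to_ac f ^ m = Poly_Mapping.map to_ac (f ^ m)" for m
      by (induction m) simp_all
    then have "Poly_Mapping.map to_ac f ^ k \<in> M"
      using f M_I[of "f ^ k"] by simp
    moreover have "Poly_Mapping.keys (Poly_Mapping.map to_ac f) = Poly_Mapping.keys f"
      by (simp add: set_eq_iff in_keys_iff lookup_map)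
    then have "Poly_Mapping.map to_ac f \<in> carrier (mpoly_ring n)"
      using f(1) by (simp add: mem_mpoly_ring)
    ultimately show ?thesis
      using split M_I f(1) by blast
  qed
  then show ?thesis
    using radical_ideal_iff[OF I] by blast
qed

section \<open>Minimal polynomials and the dimension of the quotient\<close>

lemma quot_class_eq_iff:
  assumes "ideal I (mpoly_ring n)" "p \<in> carrier (mpoly_ring n)" "q \<in> carrier (mpoly_ring n)"
  shows "I +>\<^bsub>mpoly_ring n\<^esub> p = I +>\<^bsub>mpoly_ring n\<^esub> q \<longleftrightarrow> p - q \<in> I"
  using ring.quotient_eq_iff_same_a_r_cos[OF ideal.axioms(2)[OF assms(1)] assms]
  by (simp add: mpoly_ring_a_minus assms)

lemma quot_class_zero_iff:
  assumes "ideal I (mpoly_ring n)" "p \<in> carrier (mpoly_ring n)"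
  shows "I +>\<^bsub>mpoly_ring n\<^esub> p = \<zero>\<^bsub>mpoly_ring n Quot I\<^esub> \<longleftrightarrow> p \<in> I"
proof -
  have "I +>\<^bsub>mpoly_ring n\<^esub> 0 = \<zero>\<^bsub>mpoly_ring n Quot I\<^esub>"
    using ring_hom_zero[OF ideal.rcos_ring_hom[OF assms(1)] ideal.axioms(2)[OF assms(1)]
        ideal.quotient_is_ring[OF assms(1)]]
    by simp
  then show ?thesis
    using quot_class_eq_iff[OF assms, of 0] by simp
qed

lemma subfield_quot_consts:
  fixes I :: "'k::field mpoly set"
  assumes "zero_dimensional n I"
  shows "subfield (quot_consts n I) (mpoly_ring n Quot I)"
proof -
  let ?P = "mpoly_ring n :: 'k mpoly ring"
  have I: "ideal I ?P"
    using assms by (simp add: zero_dimensional_def)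
  interpret ring_hom_ring ?P "?P Quot I" "(+>\<^bsub>?P\<^esub>) I"
    by (rule ideal.rcos_ring_hom_ring[OF I])
  have "subfield (range mconst) ?P"
  proof (rule R.subfieldI)
    show "subcring (range mconst) ?P"
    proof (intro R.subcringI R.subringI)
      fix h assume "h \<in> range (mconst :: 'k \<Rightarrow> _)"
      then obtain c where "h = mconst c" by blast
      then have "\<ominus>\<^bsub>?P\<^esub> h = mconst (- c)"
        by (simp add: mpoly_ring_a_inv)
      then show "\<ominus>\<^bsub>?P\<^esub> h \<in> range mconst"
        by blast
    qed (auto simp: mult.commute simp flip: mconst.hom_1 mconst.hom_add mconst.hom_mult)
    show "Units (?P\<lparr>carrier := range mconst\<rparr>) = range mconst - {\<zero>\<^bsub>?P\<^esub>}"
    proof (intro equalityI subsetI)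
      fix u assume "u \<in> Units (?P\<lparr>carrier := range mconst\<rparr>)"
      then show "u \<in> range mconst - {\<zero>\<^bsub>?P\<^esub>}"
        by (auto simp: Units_def)
    next
      fix u assume u: "u \<in> range mconst - {\<zero>\<^bsub>?P\<^esub>}"
      then obtain c where c: "u = mconst c"
        by blast
      have "c \<noteq> 0"
      proof
        assume "c = 0"
        then show False
          using u c by simp
      qed
      then have "mconst (inverse c * c) = (1 :: 'k mpoly)"
        by simp
      then have "mconst (inverse c) * u = 1" "u * mconst (inverse c) = 1"
        unfolding c mconst.hom_mult by (simp_all only: mult.commute)
      then show "u \<in> Units (?P\<lparr>carrier := range mconst\<rparr>)"
        using c unfolding Units_def by (intro CollectI conjI bexI[of _ "mconst (inverse c)"]) simp_all
    qed
  qed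
  moreover have "\<one>\<^bsub>?P Quot I\<^esub> \<noteq> \<zero>\<^bsub>?P Quot I\<^esub>"
    using assms S.carrier_one_zero by (auto simp: zero_dimensional_def)
  ultimately have "subfield ((+>\<^bsub>?P\<^esub>) I ` range mconst) (?P Quot I)"
    by (rule img_is_subfield)
  then show ?thesis
    by (simp add: quot_consts_def image_image)
qed

text \<open>
  Linear combinations of powers of \<open>f\<close> in \<open>P/I\<close> are values of polynomials at \<open>f\<close>. The shift \<open>k\<close>
  is what the induction along the list needs; the case \<open>k = 0\<close> is the one of interest. The list of
  coefficients may be shorter than the list of powers, since linear combinations ignore the
  excess.
\<close>

lemma combine_powers:
  fixes I :: "'k::field mpoly set"
  assumes I: "ideal I (mpoly_ring n)" and f: "f \<in> carrier (mpoly_ring n)"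
  shows "length cs \<le> m \<Longrightarrow>
    ring.combine (mpoly_ring n Quot I) (map (\<lambda>c. I +>\<^bsub>mpoly_ring n\<^esub> mconst c) cs)
      (map (\<lambda>j. I +>\<^bsub>mpoly_ring n\<^esub> f ^ j) [k..<k + m])
    = I +>\<^bsub>mpoly_ring n\<^esub> (poly (map_poly mconst (Poly cs)) f * f ^ k)"
proof (induction cs arbitrary: k m)
  case Nil
  then show ?case
    using quot_class_zero_iff[OF I, of 0] mpoly_ideal_0[OF I]
    by (simp add: ring.combine.simps[OF ideal.quotient_is_ring[OF I]])
next
  case (Cons c cs)
  let ?P = "mpoly_ring n :: 'k mpoly ring"
  interpret ring_hom_ring ?P "?P Quot I" "(+>\<^bsub>?P\<^esub>) I"
    by (rule ideal.rcos_ring_hom_ring[OF I])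
  define e where "e = poly (map_poly mconst (Poly cs)) f"
  have e: "e \<in> carrier ?P"
    using f by (simp add: e_def)
  obtain m' where m: "m = Suc m'" "length cs \<le> m'"
    using Cons.prems by (cases m) auto
  have upt: "[k..<k + m] = k # [Suc k..<Suc k + m']"
    by (simp add: m(1) upt_conv_Cons del: upt_Suc)
  have "S.combine (map (\<lambda>c. I +>\<^bsub>?P\<^esub> mconst c) (c # cs))
          (map (\<lambda>j. I +>\<^bsub>?P\<^esub> f ^ j) [k..<k + m])
      = (I +>\<^bsub>?P\<^esub> mconst c) \<otimes>\<^bsub>?P Quot I\<^esub> (I +>\<^bsub>?P\<^esub> f ^ k)
          \<oplus>\<^bsub>?P Quot I\<^esub> (I +>\<^bsub>?P\<^esub> (e * f ^ Suc k))"
    unfolding upt list.map S.combine.simps e_def by (subst Cons.IH[OF m(2)]) (rule refl)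
  also have "\<dots> = I +>\<^bsub>?P\<^esub> (mconst c * f ^ k + e * f ^ Suc k)"
    using f e hom_add[of "mconst c * f ^ k" "e * f ^ Suc k"] hom_mult[of "mconst c" "f ^ k"]
    by simp
  also have "mconst c * f ^ k + e * f ^ Suc k = poly (map_poly mconst (Poly (c # cs))) f * f ^ k"
    by (simp add: e_def algebra_simps)
  finally show ?case .
qed

text \<open>
  In dimension \<open>d\<close> the \<open>d + 1\<close> powers \<open>1, f, \<dots>, f\<^sup>d\<close> are dependent. Without this the definite
  description in \<^const>\<open>min_poly\<close> would not denote a minimal polynomial.
\<close>

lemma kernel_nontrivial:
  fixes I :: "'k::field mpoly set"
  assumes zd: "zero_dimensional n I" and f: "f \<in> carrier (mpoly_ring n)"
  shows "\<exists>g. g \<noteq> 0 \<and> poly (map_poly mconst g) f \<in> I"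
proof -
  let ?P = "mpoly_ring n :: 'k mpoly ring"
  have I: "ideal I ?P"
    using zd by (simp add: zero_dimensional_def)
  interpret ring_hom_ring ?P "?P Quot I" "(+>\<^bsub>?P\<^esub>) I"
    by (rule ideal.rcos_ring_hom_ring[OF I])
  note K = subfield_quot_consts[OF zd]
  obtain d where d: "S.dimension d (quot_consts n I) (carrier (?P Quot I))"
    using zd by (auto simp: zero_dimensional_def S.finite_dimension_def)
  define Us where "Us = map (\<lambda>j. I +>\<^bsub>?P\<^esub> f ^ j) [0..<Suc d]"
  have Us: "set Us \<subseteq> carrier (?P Quot I)" "length Us = Suc d"
    using f by (auto simp: Us_def)
  have "S.dependent (quot_consts n I) Us"
  proof
    assume "S.independent (quot_consts n I) Us"
    from S.independent_length_le_dimension[OF K d this Us(1)] show False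
      by (simp add: Us(2))
  qed
  then obtain Ks where Ks: "length Ks = length Us" "S.combine Ks Us = \<zero>\<^bsub>?P Quot I\<^esub>"
    "set Ks \<subseteq> quot_consts n I" "set Ks \<noteq> {\<zero>\<^bsub>?P Quot I\<^esub>}"
    using S.dependent_imp_non_trivial_combine[OF K Us(1)] by blast
  have "\<exists>cs. Ks = map (\<lambda>c. I +>\<^bsub>?P\<^esub> mconst c) cs"
    unfolding ex_map_conv using Ks(3) by (auto simp: quot_consts_def)
  then obtain cs where cs: "Ks = map (\<lambda>c. I +>\<^bsub>?P\<^esub> mconst c) cs"
    by blast
  have "S.combine Ks Us = I +>\<^bsub>?P\<^esub> poly (map_poly mconst (Poly cs)) f"
    using combine_powers[OF I f, of cs "Suc d" 0] Ks(1) Us(2) by (simp add: cs Us_def del: upt_Suc)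
  then have "I +>\<^bsub>?P\<^esub> poly (map_poly mconst (Poly cs)) f = \<zero>\<^bsub>?P Quot I\<^esub>"
    using Ks(2) by simp
  then have "poly (map_poly mconst (Poly cs)) f \<in> I"
    using quot_class_zero_iff[OF I mpoly_ring_eval[OF f]] by blast
  moreover have "Poly cs \<noteq> 0"
  proof
    assume "Poly cs = 0"
    then obtain m where "cs = replicate m 0"
      by (auto simp: Poly_eq_0)
    moreover have "I +>\<^bsub>?P\<^esub> mconst 0 = \<zero>\<^bsub>?P Quot I\<^esub>"
      using quot_class_zero_iff[OF I, of 0] mpoly_ideal_0[OF I] by simp
    ultimately have "set Ks \<subseteq> {\<zero>\<^bsub>?P Quot I\<^esub>}"
      unfolding cs by (simp add: set_replicate_conv_if del: replicate.simps)
    moreover have "set Ks \<noteq> {}"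
      using Ks(1) Us(2) by (metis Suc_neq_Zero list.size(3) set_empty)
    ultimately show False
      using Ks(4) subset_singletonD by metis
  qed
  ultimately show ?thesis
    by blast
qed

lemma min_poly_correct:
  fixes I :: "'k::field mpoly set"
  assumes zd: "zero_dimensional n I" and f: "f \<in> carrier (mpoly_ring n)"
  shows lead_coeff_min_poly: "lead_coeff (min_poly n I f) = 1"
    and min_poly_dvd_iff: "min_poly n I f dvd g \<longleftrightarrow> poly (map_poly mconst g) f \<in> I"
proof -
  have I: "ideal I (mpoly_ring n)"
    using zd by (simp add: zero_dimensional_def)
  define N where "N = {g. poly (map_poly mconst g) f \<in> I}"
  have N: "{g. eval_mod n I f g = \<zero>\<^bsub>mpoly_ring n Quot I\<^esub>} = N"
    unfolding N_def eval_mod_def by (simp only: quot_class_zero_iff[OF I mpoly_ring_eval[OF f]])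
  obtain g0 where g0: "g0 \<noteq> 0" "g0 \<in> N"
    using kernel_nontrivial[OF zd f] by (auto simp: N_def)
  have "\<exists>\<mu>. lead_coeff \<mu> = 1 \<and> N = {g. \<mu> dvd g}"
  proof (rule poly_ideal_principal[OF _ _ g0(2,1)])
    show "p + q \<in> N" if "p \<in> N" "q \<in> N" for p q
      using that mpoly_ideal_add[OF I] by (simp add: N_def)
    show "p * q \<in> N" if "q \<in> N" for p q
      using that mpoly_ideal_mult[OF I _ mpoly_ring_eval[OF f]] by (simp add: N_def)
  qed
  then have "\<exists>!\<mu>. lead_coeff \<mu> = 1 \<and> N = {g. \<mu> dvd g}"
  proof (rule ex_ex1I)
    fix \<mu> \<nu> assume \<mu>: "lead_coeff \<mu> = 1 \<and> N = {g. \<mu> dvd g}"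
      and \<nu>: "lead_coeff \<nu> = 1 \<and> N = {g. \<nu> dvd g}"
    have mem: "g \<in> N \<longleftrightarrow> \<mu> dvd g" "g \<in> N \<longleftrightarrow> \<nu> dvd g" for g
      by (subst conjunct2[OF \<mu>], simp) (subst conjunct2[OF \<nu>], simp)
    have "\<mu> dvd \<nu>" "\<nu> dvd \<mu>"
      using mem[of \<mu>] mem[of \<nu>] by simp_all
    then show "\<mu> = \<nu>"
      by (rule monic_dvd_antisym[OF conjunct1[OF \<mu>] conjunct1[OF \<nu>]])
  qed
  from theI'[OF this] have *: "lead_coeff (min_poly n I f) = 1 \<and> N = {g. min_poly n I f dvd g}"
    unfolding min_poly_def N .
  then show "lead_coeff (min_poly n I f) = 1"
    by (rule conjunct1)
  have "g \<in> N \<longleftrightarrow> min_poly n I f dvd g"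
    by (subst conjunct2[OF *]) simp
  then show "min_poly n I f dvd g \<longleftrightarrow> poly (map_poly mconst g) f \<in> I"
    by (simp add: N_def)
qed

text \<open>
  No polynomial of degree below that of the minimal polynomial vanishes at \<open>f\<close> modulo \<open>I\<close>, so the powers
  \<open>1, f, \<dots>, f\<^sup>d\<^sup>-\<^sup>1\<close> are independent and, there being \<open>d\<close> of them, span \<open>P/I\<close>.
\<close>

lemma generated_by_if_degree_eq_dim:
  fixes I :: "'k::field mpoly set"
  assumes zd: "zero_dimensional n I" and f: "f \<in> carrier (mpoly_ring n)"
    and deg: "degree (min_poly n I f) = quot_dim n I" and p: "p \<in> carrier (mpoly_ring n)"
  shows "\<exists>g. p - poly (map_poly mconst g) f \<in> I"
proof -
  let ?P = "mpoly_ring n :: 'k mpoly ring"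
  have I: "ideal I ?P"
    using zd by (simp add: zero_dimensional_def)
  interpret ring_hom_ring ?P "?P Quot I" "(+>\<^bsub>?P\<^esub>) I"
    by (rule ideal.rcos_ring_hom_ring[OF I])
  note K = subfield_quot_consts[OF zd]
  define d where "d = quot_dim n I"
  have d: "S.dimension d (quot_consts n I) (carrier (?P Quot I))"
    using S.finite_dimensionE[OF K] zd
    by (simp add: zero_dimensional_def d_def quot_dim_def over_def)
  define Us where "Us = map (\<lambda>j. I +>\<^bsub>?P\<^esub> f ^ j) [0..<d]"
  have Us: "set Us \<subseteq> carrier (?P Quot I)" "length Us = d"
    using f by (auto simp: Us_def)
  have comb: "\<exists>cs. length cs \<le> d \<and> take d Ks = map (\<lambda>c. I +>\<^bsub>?P\<^esub> mconst c) cs \<and>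
      S.combine Ks Us = I +>\<^bsub>?P\<^esub> poly (map_poly mconst (Poly cs)) f"
    if "set Ks \<subseteq> quot_consts n I" for Ks
  proof -
    have "set (take d Ks) \<subseteq> quot_consts n I"
      using that set_take_subset[of d Ks] by blast
    then have "\<exists>cs. take d Ks = map (\<lambda>c. I +>\<^bsub>?P\<^esub> mconst c) cs"
      unfolding ex_map_conv by (auto simp: quot_consts_def)
    then obtain cs where cs: "take d Ks = map (\<lambda>c. I +>\<^bsub>?P\<^esub> mconst c) cs"
      by blast
    then have "length cs \<le> d"
      by (metis length_map length_take min.cobounded2)
    moreover have "S.combine Ks Us = S.combine (take d Ks) Us"
      using S.combine_take[of Us Ks] Us(2) by simp
    ultimately show ?thesis
      using combine_powers[OF I f, of cs d 0] cs by (auto simp: Us_def)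
  qed
  have "S.independent (quot_consts n I) Us"
  proof (rule S.trivial_combine_imp_independent[OF K Us(1)])
    fix Ks assume Ks: "set Ks \<subseteq> quot_consts n I" "S.combine Ks Us = \<zero>\<^bsub>?P Quot I\<^esub>"
    then obtain cs where cs: "length cs \<le> d" "take d Ks = map (\<lambda>c. I +>\<^bsub>?P\<^esub> mconst c) cs"
      "I +>\<^bsub>?P\<^esub> poly (map_poly mconst (Poly cs)) f = \<zero>\<^bsub>?P Quot I\<^esub>"
      using comb by metis
    then have dvd: "min_poly n I f dvd Poly cs"
      using quot_class_zero_iff[OF I mpoly_ring_eval[OF f]] min_poly_dvd_iff[OF zd f] by blast
    have "Poly cs = 0"
    proof (rule ccontr)
      assume "Poly cs \<noteq> 0"
      then have "degree (Poly cs) < length cs"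
        by (rule degree_Poly_less)
      moreover have "d \<le> degree (Poly cs)"
        using dvd_imp_degree_le[OF dvd \<open>Poly cs \<noteq> 0\<close>] deg by (simp add: d_def)
      ultimately show False
        using cs(1) by simp
    qed
    then obtain m where "cs = replicate m 0"
      by (auto simp: Poly_eq_0)
    moreover have "I +>\<^bsub>?P\<^esub> mconst 0 = \<zero>\<^bsub>?P Quot I\<^esub>"
      using quot_class_zero_iff[OF I, of 0] mpoly_ideal_0[OF I] by simp
    ultimately show "set (take (length Us) Ks) \<subseteq> {\<zero>\<^bsub>?P Quot I\<^esub>}"
      unfolding Us(2) cs(2) by (simp add: set_replicate_conv_if del: replicate.simps)
  qed
  then have "S.Span (quot_consts n I) Us = carrier (?P Quot I)"
    using S.independent_length_eq_dimension[OF K d] Us by blast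
  then have "I +>\<^bsub>?P\<^esub> p \<in> S.Span (quot_consts n I) Us"
    using hom_closed[OF p] by simp
  then obtain Ks where "set Ks \<subseteq> quot_consts n I" "I +>\<^bsub>?P\<^esub> p = S.combine Ks Us"
    using S.Span_eq_combine_set[OF K Us(1)] by auto
  then obtain cs where "I +>\<^bsub>?P\<^esub> p = I +>\<^bsub>?P\<^esub> poly (map_poly mconst (Poly cs)) f"
    using comb by metis
  then show ?thesis
    using quot_class_eq_iff[OF I p] f by auto
qed

section \<open>Correctness of the procedure\<close>

text \<open>If \<open>g\<^sup>2 h\<close> is the minimal polynomial, then \<open>g h\<close> already vanishes at \<open>f\<close> modulo a radical ideal.\<close>

lemma squarefree_min_poly_if_radical:
  fixes I :: "'k::field mpoly set"
  assumes zd: "zero_dimensional n I" and rad: "radical_ideal I (mpoly_ring n)"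
    and f: "f \<in> carrier (mpoly_ring n)"
  shows "squarefree (min_poly n I f)"
proof (rule squarefreeI)
  have I: "ideal I (mpoly_ring n)"
    using zd by (simp add: zero_dimensional_def)
  fix g assume "g ^ 2 dvd min_poly n I f"
  then obtain h where h: "min_poly n I f = g ^ 2 * h"
    by blast
  have "min_poly n I f dvd (g * h) ^ 2"
    by (simp add: h power_mult_distrib power2_eq_square mult_ac)
  then have "(poly (map_poly mconst (g * h)) f) ^ 2 \<in> I"
    by (simp only: min_poly_dvd_iff[OF zd f] mconst.eval_power)
  then have "poly (map_poly mconst (g * h)) f \<in> I"
    using rad f unfolding radical_ideal_iff[OF I] by (metis mpoly_ring_eval)
  then have "min_poly n I f dvd g * h"
    using min_poly_dvd_iff[OF zd f] by blast
  moreover have "min_poly n I f = g * (g * h)"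
    by (simp add: h power2_eq_square mult_ac)
  ultimately have "g * (g * h) dvd 1 * (g * h)"
    by (simp only: mult_1_left)
  moreover have "g * h \<noteq> 0"
    using lead_coeff_min_poly[OF zd f] by (auto simp: h)
  ultimately show "g dvd 1"
    by (simp only: dvd_mult_cancel_right simp_thms)
qed

text \<open>
  Modulo \<open>I\<close> every polynomial \<open>p\<close> is a value \<open>g(f)\<close>, and \<open>p ^ k \<in> I\<close> says that the minimal
  polynomial divides \<open>g ^ k\<close>; being square-free, it divides \<open>g\<close>.
\<close>

lemma radical_if_squarefree_of_max_degree:
  fixes I :: "'k::field mpoly set"
  assumes zd: "zero_dimensional n I" and f: "f \<in> carrier (mpoly_ring n)"
    and sf: "squarefree (min_poly n I f)" and deg: "degree (min_poly n I f) = quot_dim n I"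
  shows "radical_ideal I (mpoly_ring n)"
proof -
  have I: "ideal I (mpoly_ring n)"
    using zd by (simp add: zero_dimensional_def)
  have "p \<in> I" if p: "p \<in> carrier (mpoly_ring n)" "p ^ k \<in> I" for p k
  proof -
    obtain g where g: "p - poly (map_poly mconst g) f \<in> I"
      using generated_by_if_degree_eq_dim[OF zd f deg p(1)] by blast
    define e where "e = poly (map_poly mconst g) f"
    have e: "e \<in> carrier (mpoly_ring n)"
      using f by (simp add: e_def)
    have "p ^ j - e ^ j \<in> I" for j
    proof (induction j)
      case (Suc j)
      have "p * (p ^ j - e ^ j) + e ^ j * (p - e) \<in> I"
        by (rule mpoly_ideal_add[OF I mpoly_ideal_mult[OF I Suc p(1)]
              mpoly_ideal_mult[OF I g[folded e_def] mpoly_ring_power[OF e]]])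
      then show ?case
        by (simp add: algebra_simps)
    qed (simp add: mpoly_ideal_0[OF I])
    from mpoly_ideal_diff[OF I p(2) this[of k]] have "e ^ k \<in> I"
      by simp
    then have "min_poly n I f dvd g ^ k"
      by (simp add: min_poly_dvd_iff[OF zd f] e_def)
    then have "min_poly n I f dvd g"
      by (rule squarefree_dvd_power[OF sf])
    then have "e \<in> I"
      by (simp add: min_poly_dvd_iff[OF zd f] e_def)
    from mpoly_ideal_add[OF I g[folded e_def] this] show ?thesis
      by simp
  qed
  then show ?thesis
    using radical_ideal_iff[OF I] by blast
qed

lemma radical_test_loop_correct:
  fixes I :: "'k::field mpoly set"
  assumes perf: "perfect_field TYPE('k)" and zd: "zero_dimensional n I"
    and i: "1 \<le> i" "i \<le> Suc n"
    and sf: "\<And>j. j \<in> {1..<i} \<Longrightarrow> squarefree (min_poly n I (mvar j))"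
  shows "radical_test_loop n I (quot_dim n I) i = Some (radical_ideal I (mpoly_ring n))"
  using i sf
proof (induction "Suc n - i" arbitrary: i)
  case 0
  then have "i = Suc n"
    by simp
  have I: "ideal I (mpoly_ring n)"
    using zd by (simp add: zero_dimensional_def)
  have "poly (map_poly mconst (min_poly n I (mvar j))) (mvar j) \<in> I" if "j \<in> {1..n}" for j
    using min_poly_dvd_iff[OF zd mpoly_ring_mvar[OF that]] dvd_refl by blast
  moreover have "squarefree (min_poly n I (mvar j))" if "j \<in> {1..n}" for j
    using that 0(4) \<open>i = Suc n\<close> by simp
  ultimately have "radical_ideal I (mpoly_ring n)"
    by (intro radical_if_squarefree_in_each_variable[OF perf I]) blast
  then show ?case
    using \<open>i = Suc n\<close> by (subst radical_test_loop.simps) simp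
next
  case (Suc m)
  define \<mu> where "\<mu> = min_poly n I (mvar i)"
  have "i \<le> n"
    using Suc.hyps(2) by simp
  then have x: "mvar i \<in> carrier (mpoly_ring n)"
    using Suc.prems(1) by simp
  consider "\<not> squarefree \<mu>" | "squarefree \<mu>" "degree \<mu> = quot_dim n I"
    | "squarefree \<mu>" "degree \<mu> \<noteq> quot_dim n I"
    by blast
  then show ?case
  proof cases
    case 1
    then have "\<not> radical_ideal I (mpoly_ring n)"
      using squarefree_min_poly_if_radical[OF zd _ x] by (auto simp: \<mu>_def)
    then show ?thesis
      using 1 \<open>i \<le> n\<close> by (subst radical_test_loop.simps) (simp add: \<mu>_def)
  next
    case 2
    then have "radical_ideal I (mpoly_ring n)"
      using radical_if_squarefree_of_max_degree[OF zd x] by (simp add: \<mu>_def)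
    then show ?thesis
      using 2 \<open>i \<le> n\<close> by (subst radical_test_loop.simps) (simp add: \<mu>_def)
  next
    case 3
    have "radical_test_loop n I (quot_dim n I) (i + 1) = Some (radical_ideal I (mpoly_ring n))"
    proof (rule Suc.hyps(1))
      show "squarefree (min_poly n I (mvar j))" if "j \<in> {1..<i + 1}" for j
        using that Suc.prems(3)[of j] 3(1) by (cases "j = i") (simp_all add: \<mu>_def)
    qed (use Suc.hyps(2) \<open>i \<le> n\<close> in simp_all)
    then show ?thesis
      using 3 \<open>i \<le> n\<close> by (subst radical_test_loop.simps) (simp add: \<mu>_def)
  qed
qed

theorem mainTheorem5:
  fixes n :: nat and I :: "'k::field mpoly set"
  assumes "perfect_field TYPE('k)"
    and "zero_dimensional n I"
  shows "radical_test n I = Some (radical_ideal I (mpoly_ring n))"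
  using radical_test_loop_correct[OF assms, of 1] by (simp add: radical_test_def)

end
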